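(* Let $a,c\in\mathbb{C}$. (1) Let the contour $[0,1]\ni s\mapsto\gamma(s)$ satisfy $$t^{a-c+1}e^t(t-z)^{-a-1}\Big|_{t=\gamma(0)}^{t=\gamma(1)}=0.$$ Then $$\mathcal{F}(a;c;z,\partial_z)\int_\gamma t^{a-c}e^t(t-z)^{-a}\,dt=0.$$ (2) Let the contour $[0,1]\ni s\mapsto\gamma(s)$ satisfy $$e^{\frac{z}{t}}t^{-c}(1-t)^{c-a}\Big|_{t=\gamma(0)}^{t=\gamma(1)}=0.$$ Then $$\mathcal{F}(a;c;z,\partial_z)\int_\gamma e^{\frac{z}{t}}t^{-c}(1-t)^{c-a-1}\,dt=0.$$
   Context: The confluent (${}_1F_1$) operator is $\mathcal{F}(a;c;z,\partial_z):=z\partial_z^2+(c-z)\partial_z-a$, where $z$ is a complex variable. Notation: $f(t)\big|_{t=\gamma(0)}^{t=\gamma(1)}:=f(\gamma(1))-f(\gamma(0))$, which for a curve $\gamma$ equals $\int_\gamma f'(t)\,dt$. Power functions are the principal branches $w^\mu=e^{\mu\log w}$, extended where needed by analytic continuation to the appropriate covering of $\mathbb{C}\setminus\{0\}$. *)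

theory Defs
  imports "HOL-Complex_Analysis.Complex_Analysis"
begin

definition confluent_op :: "complex \<Rightarrow> complex \<Rightarrow> (complex \<Rightarrow> complex) \<Rightarrow> complex \<Rightarrow> complex" where
  "confluent_op a c f z = z * deriv (deriv f) z + (c - z) * deriv f z - a * f z"

text \<open>
  The integrands are multivalued, so a contour lives on a covering of the punctured plane.
  The universal covering of the plane without \<open>0\<close> is \<open>exp\<close>, hence a lift of a curve \<open>p\<close> avoiding \<open>0\<close>
  is a continuous choice \<open>l s\<close> of \<open>log (p s)\<close>. Any starting sheet is allowed.
\<close>

definition log_along :: "(real \<Rightarrow> complex) \<Rightarrow> (real \<Rightarrow> complex) \<Rightarrow> bool" where
  "log_along p l \<longleftrightarrow> continuous_on {0..1} l \<and> (\<forall>s\<in>{0..1}. exp (l s) = p s)"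

text \<open>
  The same for the family of curves \<open>\<lambda>s. \<gamma> s - w\<close>, jointly continuous in the parameter \<open>w \<in> U\<close>, so
  that powers of \<open>t - w\<close> are continued analytically in \<open>w\<close> as well as along the contour.
  As \<open>exp\<close> has no zeros, it forces \<open>\<gamma>\<close> to avoid \<open>U\<close>.
\<close>

definition log_along_shifted ::
    "complex set \<Rightarrow> (real \<Rightarrow> complex) \<Rightarrow> (complex \<Rightarrow> real \<Rightarrow> complex) \<Rightarrow> bool" where
  "log_along_shifted U \<gamma> l \<longleftrightarrow>
     continuous_on (U \<times> {0..1}) (\<lambda>(w, s). l w s) \<and>
     (\<forall>w\<in>U. \<forall>s\<in>{0..1}. exp (l w s) = \<gamma> s - w)"

text \<open>The power \<open>p\<^sup>\<mu>\<close> for the choice \<open>l\<close> of \<open>log p\<close>.\<close>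

definition pow_of_log :: "complex \<Rightarrow> complex \<Rightarrow> complex" where
  "pow_of_log l \<mu> = exp (\<mu> * l)"

text \<open>
  On the covering, the integrand is a function of the curve parameter \<open>s\<close> and not of the point
  \<open>\<gamma> s\<close>. For \<open>h = f \<circ> \<gamma>\<close> this is the library's \<open>contour_integral \<gamma> f\<close>.
\<close>

definition lifted_contour_integral :: "(real \<Rightarrow> complex) \<Rightarrow> (real \<Rightarrow> complex) \<Rightarrow> complex" where
  "lifted_contour_integral \<gamma> h =
     integral {0..1} (\<lambda>s. h s * vector_derivative \<gamma> (at s within {0..1}))"

definition endpoint_diff :: "(real \<Rightarrow> complex) \<Rightarrow> complex" where
  "endpoint_diff h = h 1 - h 0"

end

theory Submission
  imports Defs
begin

text \<open>
  In both parts the operator \<open>\<F>(a;c;z,\<partial>\<^sub>z)\<close>, applied to the integrand under the integral sign, gives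
  a constant times the \<open>t\<close>-derivative of the function whose endpoint difference is assumed to vanish:
  with \<open>P = t\<^bsup>a-c\<^esup> e\<^sup>t\<close> and \<open>Q = e\<^bsup>z/t\<^esup> t\<^bsup>-c\<^esup>\<close>,
  \<open>\<F> (P (t - z)\<^bsup>-a\<^esup>) = - a d/dt (t P (t - z)\<^bsup>-a-1\<^esup>)\<close> and
  \<open>\<F> (Q (1 - t)\<^bsup>c-a-1\<^esup>) = - d/dt (Q (1 - t)\<^bsup>c-a\<^esup>)\<close>.
  Each is an elementary computation after extracting the lowest powers of \<open>t\<close>, \<open>t - z\<close>, \<open>1 - t\<close>
  (\<open>confluent_op_shifted_power_integral\<close>, \<open>confluent_op_exp_power_integral\<close>), and the integral of
  the derivative along the contour is the endpoint difference (\<open>has_integral_exact_form\<close>).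

  The analytic content is differentiation under the integral sign. A valid path is continuous, and
  continuously differentiable off a finite set, but its derivative may be unbounded near the
  exceptional points: the path can have infinite length, and the integral may exist only as a
  gauge integral. So no estimate of the difference quotient against the arc length is available. Instead,
  locally in the curve parameter the integrand is the pullback of a function \<open>f w t\<close> holomorphic in \<open>w\<close>
  and \<open>t\<close>, and a primitive in \<open>t\<close> shows that the integral over a short piece of the contour equals the
  integral of \<open>f w\<close> over the straight segment between the endpoints of that piece. There the classical
  Leibniz rule applies. Bisection of the unit interval glues the pieces together
  (\<open>differentiates_under_integral_if_locally_holomorphic\<close>).

  The integrands have the required local form because a continuous logarithm along the contour agrees,
  near each parameter value, with a branch of the logarithm of the point (\<open>log_lift_eq_branch\<close>).
\<close>

section \<open>Differentiation under a contour integral of possibly infinite length\<close>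

text \<open>
  The local model of an integrand on \<open>ball z r \<times> ball t0 r\<close>. Holomorphy in the integration variable
  \<open>t\<close> provides primitives, for \<open>f'\<close> as well as for \<open>f\<close>; joint continuity of the \<open>w\<close>-derivative is what
  the Leibniz rule on a segment consumes.
\<close>

definition holomorphic_family ::
    "complex \<Rightarrow> complex \<Rightarrow> real \<Rightarrow> (complex \<Rightarrow> complex \<Rightarrow> complex) \<Rightarrow> (complex \<Rightarrow> complex \<Rightarrow> complex) \<Rightarrow> bool"
  where "holomorphic_family z t0 r f f' \<longleftrightarrow>
     (\<forall>w\<in>ball z r. f w holomorphic_on ball t0 r \<and> f' w holomorphic_on ball t0 r) \<and>
     continuous_on (ball z r \<times> ball t0 r) (\<lambda>(w, t). f' w t) \<and>
     (\<forall>w\<in>ball z r. \<forall>t\<in>ball t0 r. ((\<lambda>w. f w t) has_field_derivative f' w t) (at w))"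

lemma holomorphic_familyD:
  assumes "holomorphic_family z t0 r f f'" "w \<in> ball z r"
  shows "f w holomorphic_on ball t0 r" "f' w holomorphic_on ball t0 r"
    and "\<And>t. t \<in> ball t0 r \<Longrightarrow> ((\<lambda>w. f w t) has_field_derivative f' w t) (at w)"
  using assms by (simp_all add: holomorphic_family_def)

text \<open>
  Both sides are the increment of a primitive of \<open>f\<close> on the convex set \<open>D\<close>. Replacing the path by a
  segment removes its derivative, which need not be bounded. The derivative is taken within \<open>{0..1}\<close>, not
  within \<open>{u..v}\<close>, so that the integrals over adjacent pieces add up.
\<close>

lemma integral_along_subpath_eq_linepath:
  assumes \<gamma>: "\<gamma> piecewise_differentiable_on {u..v}" and uv: "0 \<le> u" "u \<le> v" "v \<le> 1"
    and D: "convex D" "open D" "\<gamma> ` {u..v} \<subseteq> D" and f: "f holomorphic_on D"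
  shows "((\<lambda>s. f (\<gamma> s) * vector_derivative \<gamma> (at s within {0..1}))
           has_integral contour_integral (linepath (\<gamma> u) (\<gamma> v)) f) {u..v}"
proof -
  obtain F where F: "\<And>x. x \<in> D \<Longrightarrow> (F has_field_derivative f x) (at x within D)"
    using holomorphic_convex_primitive' D f by metis
  have ends: "\<gamma> u \<in> D" "\<gamma> v \<in> D" using D uv by auto
  have "closed_segment (\<gamma> u) (\<gamma> v) \<subseteq> D"
    using D ends by (simp add: closed_segment_subset)
  then have "(f has_contour_integral F (\<gamma> v) - F (\<gamma> u)) (linepath (\<gamma> u) (\<gamma> v))"
    using contour_integral_primitive[OF F, of "linepath (\<gamma> u) (\<gamma> v)"] by simp
  then have eq: "contour_integral (linepath (\<gamma> u) (\<gamma> v)) f = F (\<gamma> v) - F (\<gamma> u)"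
    by (rule contour_integral_unique)
  have *: "((\<lambda>s. f (\<gamma> s) * vector_derivative \<gamma> (at s within {u..v}))
           has_integral F (\<gamma> v) - F (\<gamma> u)) {u..v}"
    by (rule contour_integral_primitive_lemma[OF uv(2) F \<gamma>]) (use D in auto)
  have within: "at s within {u..v} = at s within {0..1}" if "s \<in> {u..v} - {u, v}" for s
    using that uv by (simp add: at_within_Icc_at)
  show ?thesis
    unfolding eq
  proof (rule has_integral_spike_finite[OF _ _ *])
    show "finite {u, v}" by simp
    fix s assume "s \<in> {u..v} - {u, v}"
    then show "f (\<gamma> s) * vector_derivative \<gamma> (at s within {0..1}) =
        f (\<gamma> s) * vector_derivative \<gamma> (at s within {u..v})"
      by (simp only: within)
  qed
qed

lemma has_field_derivative_contour_integral_linepath: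
  assumes fam: "holomorphic_family z t0 r f f'"
    and xy: "x \<in> ball t0 r" "y \<in> ball t0 r" and w: "w \<in> ball z r"
  shows "((\<lambda>w. contour_integral (linepath x y) (f w))
           has_field_derivative contour_integral (linepath x y) (f' w)) (at w)"
proof -
  have seg: "linepath x y \<tau> \<in> ball t0 r" if "\<tau> \<in> {0..1}" for \<tau>
    using that xy convex_ball[of t0 r]
    by (metis closed_segment_subset linepath_in_path subset_iff)
  have cont: "continuous_on (ball z r \<times> {0..1}) (\<lambda>p. f' (fst p) (linepath x y (snd p)) * (y - x))"
  proof -
    have "continuous_on (ball z r \<times> ball t0 r) (\<lambda>p. f' (fst p) (snd p))"
      using fam by (simp add: holomorphic_family_def case_prod_unfold)
    then have "continuous_on (ball z r \<times> {0..1})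
        (\<lambda>p. f' (fst (fst p, linepath x y (snd p))) (snd (fst p, linepath x y (snd p))))"
      by (rule continuous_on_compose2) (use seg in \<open>auto intro!: continuous_intros simp: linepath_def\<close>)
    then show ?thesis by (simp add: continuous_on_mult_right)
  qed
  have int: "(\<lambda>\<tau>. f w (linepath x y \<tau>) * (y - x)) integrable_on {0..1}" if "w \<in> ball z r" for w
  proof (intro integrable_continuous_real continuous_intros)
    have "continuous_on (ball t0 r) (f w)"
      using holomorphic_familyD(1)[OF fam that] by (rule holomorphic_on_imp_continuous_on)
    then show "continuous_on {0..1} (\<lambda>\<tau>. f w (linepath x y \<tau>))"
      by (rule continuous_on_compose2) (use seg in auto)
  qed
  have "((\<lambda>w. integral (cbox 0 1) (\<lambda>\<tau>. f w (linepath x y \<tau>) * (y - x)))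
          has_field_derivative integral (cbox 0 1) (\<lambda>\<tau>. f' w (linepath x y \<tau>) * (y - x))) (at w within ball z r)"
  proof (rule leibniz_rule_field_derivative)
    fix w \<tau> assume "w \<in> ball z r" "\<tau> \<in> cbox (0::real) 1"
    then have "((\<lambda>w. f w (linepath x y \<tau>)) has_field_derivative f' w (linepath x y \<tau>)) (at w)"
      by (intro holomorphic_familyD[OF fam] seg) simp_all
    then show "((\<lambda>w. f w (linepath x y \<tau>) * (y - x))
        has_field_derivative f' w (linepath x y \<tau>) * (y - x)) (at w within ball z r)"
      by (rule DERIV_cmult_right[OF has_field_derivative_at_within])
  next
    show "continuous_on (ball z r \<times> cbox 0 1) (\<lambda>(w, \<tau>). f' w (linepath x y \<tau>) * (y - x))"
      using cont by (simp add: case_prod_unfold)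
  next
    show "(\<lambda>\<tau>. f w (linepath x y \<tau>) * (y - x)) integrable_on cbox 0 1" if "w \<in> ball z r" for w
      using int[OF that] by simp
  qed (use w in simp_all)
  then show ?thesis
    by (simp add: contour_integral_integral at_within_open[OF w open_ball])
qed

text \<open>
  Since \<open>h w\<close> depends on the curve parameter rather than on the point of the curve, this concerns
  integrands on a covering. A whole ball is needed, and not only \<open>z\<close>, in order to differentiate twice and
  to obtain analyticity.
\<close>

definition differentiates_under_integral ::
    "(real \<Rightarrow> complex) \<Rightarrow> complex \<Rightarrow> (complex \<Rightarrow> real \<Rightarrow> complex) \<Rightarrow> (complex \<Rightarrow> real \<Rightarrow> complex) \<Rightarrow> bool"
  where "differentiates_under_integral \<gamma> z h h' \<longleftrightarrow> (\<exists>\<rho>>0. \<forall>w\<in>ball z \<rho>.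
     (\<lambda>s. h w s * vector_derivative \<gamma> (at s within {0..1})) integrable_on {0..1} \<and>
     ((\<lambda>w. lifted_contour_integral \<gamma> (h w)) has_field_derivative lifted_contour_integral \<gamma> (h' w)) (at w))"

text \<open>
  The property "there is a ball of parameters \<open>w\<close> on which the integral over \<open>{u..v}\<close> can be
  differentiated" is additive in the interval, with the smaller of the two balls, and it holds for short
  intervals by passing to segments. The bisection principle then gives it for \<open>{0..1}\<close>. The radius is
  existentially quantified inside the property because the local models come with no uniform radius.
\<close>

proposition differentiates_under_integral_if_locally_holomorphic:
  assumes \<gamma>: "valid_path \<gamma>"
    and loc: "\<And>s0. s0 \<in> {0..1} \<Longrightarrow> \<exists>r>0. \<exists>f f'. holomorphic_family z (\<gamma> s0) r f f' \<and>
        (\<forall>w\<in>ball z r. \<forall>s\<in>{0..1} \<inter> ball s0 r. h w s = f w (\<gamma> s) \<and> h' w s = f' w (\<gamma> s))"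
  shows "differentiates_under_integral \<gamma> z h h'"
proof -
  define H where "H = (\<lambda>w s. h w s * vector_derivative \<gamma> (at s within {0..1}))"
  define H' where "H' = (\<lambda>w s. h' w s * vector_derivative \<gamma> (at s within {0..1}))"
  define Q where "Q = (\<lambda>u v w. H w integrable_on {u..v} \<and> H' w integrable_on {u..v} \<and>
    ((\<lambda>w. integral {u..v} (H w)) has_field_derivative integral {u..v} (H' w)) (at w))"
  define P where "P = (\<lambda>u v. 0 \<le> u \<longrightarrow> v \<le> 1 \<longrightarrow> (\<exists>\<rho>>0. \<forall>w\<in>ball z \<rho>. Q u v w))"
  have pd: "\<gamma> piecewise_differentiable_on {0..1}"
    using \<gamma> by (simp add: valid_path_def piecewise_C1_imp_differentiable)
  have cont: "continuous_on {0..1} \<gamma>"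
    using pd by (simp add: piecewise_differentiable_on_def)
  have "P 0 1"
  proof (rule Bolzano)
    show "(0::real) \<le> 1" by simp
  next
    fix u x v assume *: "P u x" "P x v" "u \<le> x" "x \<le> v"
    show "P u v"
      unfolding P_def
    proof (intro impI)
      assume "0 \<le> u" "v \<le> 1"
      with * obtain \<rho>1 \<rho>2 where \<rho>: "\<rho>1 > 0" "\<rho>2 > 0"
        "\<And>w. w \<in> ball z \<rho>1 \<Longrightarrow> Q u x w" "\<And>w. w \<in> ball z \<rho>2 \<Longrightarrow> Q x v w"
        unfolding P_def by (metis order_trans)
      define B where "B = ball z (min \<rho>1 \<rho>2)"
      have Q1: "Q u x w" and Q2: "Q x v w" if "w \<in> B" for w
        using that \<rho> by (auto simp: B_def)
      have int: "H w integrable_on {u..v}" "H' w integrable_on {u..v}"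
        "integral {u..v} (H w) = integral {u..x} (H w) + integral {x..v} (H w)"
        "integral {u..v} (H' w) = integral {u..x} (H' w) + integral {x..v} (H' w)"
        if "w \<in> B" for w
      proof -
        show i: "H w integrable_on {u..v}" "H' w integrable_on {u..v}"
          using Q1[OF that] Q2[OF that] Henstock_Kurzweil_Integration.integrable_combine[OF *(3,4)]
          by (auto simp: Q_def)
        show "integral {u..v} (H w) = integral {u..x} (H w) + integral {x..v} (H w)"
          "integral {u..v} (H' w) = integral {u..x} (H' w) + integral {x..v} (H' w)"
          by (simp_all only: Henstock_Kurzweil_Integration.integral_combine[OF *(3,4) i(1)]
              Henstock_Kurzweil_Integration.integral_combine[OF *(3,4) i(2)])
      qed
      have "Q u v w" if "w \<in> B" for w
      proof -
        have "((\<lambda>w. integral {u..x} (H w) + integral {x..v} (H w)) has_field_derivative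
            integral {u..v} (H' w)) (at w)"
          unfolding int(4)[OF that] using Q1[OF that] Q2[OF that] by (auto simp: Q_def intro: DERIV_add)
        then have "((\<lambda>w. integral {u..v} (H w)) has_field_derivative integral {u..v} (H' w)) (at w)"
          by (rule has_field_derivative_transform_within_open[where S = B])
            (use that int(3) in \<open>auto simp: B_def\<close>)
        then show ?thesis using int[OF that] by (simp add: Q_def)
      qed
      then show "\<exists>\<rho>>0. \<forall>w\<in>ball z \<rho>. Q u v w"
        using \<rho>(1,2) by (intro exI[of _ "min \<rho>1 \<rho>2"]) (auto simp: B_def)
    qed
  next
    fix s0 :: real assume "0 \<le> s0" "s0 \<le> 1"
    then have s0: "s0 \<in> {0..1}" by simp
    from loc[OF this] obtain r f f' where r: "r > 0" and fam: "holomorphic_family z (\<gamma> s0) r f f'"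
      and hf: "\<And>w s. w \<in> ball z r \<Longrightarrow> s \<in> {0..1} \<inter> ball s0 r \<Longrightarrow> h w s = f w (\<gamma> s) \<and> h' w s = f' w (\<gamma> s)"
      by metis
    obtain d where d: "d > 0" "\<And>s. s \<in> {0..1} \<Longrightarrow> dist s s0 < d \<Longrightarrow> dist (\<gamma> s) (\<gamma> s0) < r"
      using cont s0 r by (metis continuous_on_iff)
    show "\<exists>d>0. \<forall>u v. u \<le> s0 \<and> s0 \<le> v \<and> v - u < d \<longrightarrow> P u v"
    proof (intro exI[of _ "min d r"] conjI allI impI)
      show "0 < min d r" using d r by simp
    next
      fix u v assume uv: "u \<le> s0 \<and> s0 \<le> v \<and> v - u < min d r"
      show "P u v"
        unfolding P_def
      proof (intro impI)
        assume uv01: "0 \<le> u" "v \<le> 1"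
        have near: "s \<in> {0..1}" "s \<in> ball s0 r" "\<gamma> s \<in> ball (\<gamma> s0) r" if "s \<in> {u..v}" for s
          using that uv uv01 d(2)[of s] by (auto simp: dist_real_def dist_commute)
        have pduv: "\<gamma> piecewise_differentiable_on {u..v}"
          using pd by (rule piecewise_differentiable_on_subset) (use near in auto)
        have ends: "\<gamma> u \<in> ball (\<gamma> s0) r" "\<gamma> v \<in> ball (\<gamma> s0) r"
          using near uv by auto
        have hi: "((\<lambda>s. g (\<gamma> s) * vector_derivative \<gamma> (at s within {0..1}))
             has_integral contour_integral (linepath (\<gamma> u) (\<gamma> v)) g) {u..v}"
          if "g holomorphic_on ball (\<gamma> s0) r" for g
          using that uv uv01 near pduv
          by (intro integral_along_subpath_eq_linepath[where D = "ball (\<gamma> s0) r"]) auto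
        have HI: "(H w has_integral contour_integral (linepath (\<gamma> u) (\<gamma> v)) (f w)) {u..v}"
          and HI': "(H' w has_integral contour_integral (linepath (\<gamma> u) (\<gamma> v)) (f' w)) {u..v}"
          if "w \<in> ball z r" for w
        proof -
          from holomorphic_familyD(1,2)[OF fam that, THEN hi] show "(H w has_integral contour_integral (linepath (\<gamma> u) (\<gamma> v)) (f w)) {u..v}"
            "(H' w has_integral contour_integral (linepath (\<gamma> u) (\<gamma> v)) (f' w)) {u..v}"
            unfolding H_def H'_def using hf[OF that] near
            by (auto elim!: has_integral_eq_rhs has_integral_eq[rotated])
        qed
        have "Q u v w" if w: "w \<in> ball z r" for w
        proof -
          have "((\<lambda>w. integral {u..v} (H w)) has_field_derivative integral {u..v} (H' w)) (at w)"
            unfolding integral_unique[OF HI'[OF w]]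
            by (rule has_field_derivative_transform_within_open[OF
                  has_field_derivative_contour_integral_linepath[OF fam ends w], where S = "ball z r"])
              (use w integral_unique[OF HI] in auto)
          then show ?thesis using HI[OF w] HI'[OF w] by (auto simp: Q_def)
        qed
        then show "\<exists>\<rho>>0. \<forall>w\<in>ball z \<rho>. Q u v w" using r by blast
      qed
    qed
  qed
  then obtain \<rho> where \<rho>: "\<rho> > 0" "\<And>w. w \<in> ball z \<rho> \<Longrightarrow> Q 0 1 w"
    by (auto simp: P_def)
  show ?thesis
    unfolding differentiates_under_integral_def
  proof (intro exI[of _ \<rho>] conjI ballI)
    fix w assume "w \<in> ball z \<rho>"
    from \<rho>(2)[OF this] show "(\<lambda>s. h w s * vector_derivative \<gamma> (at s within {0..1})) integrable_on {0..1}"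
      and "((\<lambda>w. lifted_contour_integral \<gamma> (h w)) has_field_derivative
             lifted_contour_integral \<gamma> (h' w)) (at w)"
      by (simp_all add: Q_def H_def H'_def lifted_contour_integral_def)
  qed (rule \<rho>(1))
qed

section \<open>Logarithms along a curve\<close>

text \<open>
  Near \<open>x0\<close> the difference \<open>l x - l x0\<close> is small by continuity, so it lies in the strip on which \<open>Ln\<close>
  inverts \<open>exp\<close>. The parameter space is an arbitrary metric space, so as to cover both a single curve and a
  family of curves with its parameter.
\<close>

lemma log_lift_eq_branch:
  fixes l :: "'a::metric_space \<Rightarrow> complex"
  assumes cont: "continuous_on X l" and l: "\<And>x. x \<in> X \<Longrightarrow> exp (l x) = p x" and x0: "x0 \<in> X"
  obtains e where "e > 0" "\<And>x. x \<in> X \<Longrightarrow> dist x x0 < e \<Longrightarrow> l x = l x0 + Ln (p x / p x0)"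
proof -
  obtain e where e: "e > 0" "\<And>x. x \<in> X \<Longrightarrow> dist x x0 < e \<Longrightarrow> dist (l x) (l x0) < pi"
    using cont x0 pi_gt_zero unfolding continuous_on_iff by metis
  show thesis
  proof (rule that[OF e(1)])
    fix x assume x: "x \<in> X" "dist x x0 < e"
    have "\<bar>Im (l x - l x0)\<bar> < pi"
      using abs_Im_le_cmod[of "l x - l x0"] e(2)[OF x] by (simp add: dist_norm)
    then have "Ln (exp (l x - l x0)) = l x - l x0"
      by (intro Ln_exp) auto
    then show "l x = l x0 + Ln (p x / p x0)"
      using l[OF x(1)] l[OF x0] by (simp add: exp_diff)
  qed
qed

lemma has_vector_derivative_log_along:
  assumes l: "log_along p l" and s: "s \<in> {0..1}"
    and p: "(p has_vector_derivative d) (at s within {0..1})"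
  shows "(l has_vector_derivative d / p s) (at s within {0..1})"
proof -
  have l': "continuous_on {0..1} l" "\<And>s. s \<in> {0..1} \<Longrightarrow> exp (l s) = p s"
    using l by (simp_all add: log_along_def)
  have nz: "p s \<noteq> 0" using l'(2)[OF s] exp_not_eq_zero[of "l s"] by metis
  obtain e where e: "e > 0" "\<And>x. x \<in> {0..1} \<Longrightarrow> dist x s < e \<Longrightarrow> l x = l s + Ln (p x / p s)"
    by (rule log_lift_eq_branch[OF l' s], assumption, rule that)
  have "((\<lambda>q. l s + Ln (q / p s)) has_field_derivative 1 / p s) (at (p s) within p ` {0..1})"
    using nz by (auto intro!: derivative_eq_intros)
  from field_vector_diff_chain_within[OF p this]
  have "((\<lambda>x. l s + Ln (p x / p s)) has_vector_derivative d / p s) (at s within {0..1})"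
    by (simp add: o_def)
  then show ?thesis
    by (rule has_vector_derivative_transform_within[OF _ e(1) s]) (simp add: e(2))
qed

lemma has_vector_derivative_pow_of_log:
  assumes l: "log_along p l" and s: "s \<in> {0..1}"
    and p: "(p has_vector_derivative d) (at s within {0..1})"
  shows "((\<lambda>s. pow_of_log (l s) \<mu>) has_vector_derivative \<mu> * pow_of_log (l s) (\<mu> - 1) * d)
           (at s within {0..1})"
proof -
  have e: "exp (l s) = p s" using l s by (auto simp: log_along_def)
  have "((\<lambda>x. exp (\<mu> * x)) has_field_derivative \<mu> * exp (\<mu> * l s)) (at (l s) within l ` {0..1})"
    by (auto intro!: derivative_eq_intros)
  from field_vector_diff_chain_within[OF has_vector_derivative_log_along[OF assms] this]
  show ?thesis
    by (simp add: pow_of_log_def o_def algebra_simps exp_diff e)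
qed

lemma pow_of_log_add_1:
  "exp l = p \<Longrightarrow> pow_of_log l (\<mu> + 1) = pow_of_log l \<mu> * p"
  by (simp add: pow_of_log_def distrib_right exp_add)

lemma continuous_on_pow_of_log:
  "log_along p l \<Longrightarrow> continuous_on {0..1} (\<lambda>s. pow_of_log (l s) \<mu>)"
  unfolding log_along_def pow_of_log_def by (intro continuous_intros) simp

text \<open>Keeps the arguments of the local branches \<open>l x0 + Ln (q / q0)\<close> off the cut of \<open>Ln\<close>.\<close>

lemma divide_notin_nonpos_Reals:
  fixes q q0 :: complex
  assumes "dist q q0 < cmod q0"
  shows "q / q0 \<notin> \<real>\<^sub>\<le>\<^sub>0"
proof
  have q0: "q0 \<noteq> 0" using assms by auto
  assume "q / q0 \<in> \<real>\<^sub>\<le>\<^sub>0"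
  then have "1 \<le> \<bar>Re (q / q0 - 1)\<bar>" by (simp add: complex_nonpos_Reals_iff)
  also have "\<dots> \<le> cmod (q / q0 - 1)" by (rule abs_Re_le_cmod)
  also have "\<dots> = dist q q0 / cmod q0"
    using q0 by (simp add: dist_norm norm_divide[symmetric] diff_divide_distrib)
  finally show False using assms q0 by (simp add: field_simps)
qed

section \<open>The two families of integrands\<close>

text \<open>
  Lowering the exponent \<open>\<nu>\<close> by one is the \<open>w\<close>-derivative of \<open>(t - w)\<^sup>\<nu>\<close> up to the factor \<open>- \<nu>\<close>; the
  exponent is kept general because the second derivative needs the statement again for \<open>\<nu> - 1\<close>.
\<close>

lemma differentiates_shifted_power_integral:
  fixes \<mu> \<nu> :: complex
  assumes \<gamma>: "valid_path \<gamma>" and U: "open U" "z \<in> U"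
    and l0: "log_along \<gamma> l0" and l1: "log_along_shifted U \<gamma> l1"
  defines "h \<equiv> \<lambda>\<nu> w s. pow_of_log (l0 s) \<mu> * exp (\<gamma> s) * pow_of_log (l1 w s) \<nu>"
  shows "differentiates_under_integral \<gamma> z (h \<nu>) (\<lambda>w s. - \<nu> * h (\<nu> - 1) w s)"
proof -
  have l0': "continuous_on {0..1} l0" "\<And>s. s \<in> {0..1} \<Longrightarrow> exp (l0 s) = \<gamma> s"
    using l0 by (auto simp: log_along_def)
  have l1': "continuous_on (U \<times> {0..1}) (\<lambda>p. l1 (fst p) (snd p))"
    "\<And>p. p \<in> U \<times> {0..1} \<Longrightarrow> exp (l1 (fst p) (snd p)) = \<gamma> (snd p) - fst p"
    using l1 by (auto simp: log_along_shifted_def case_prod_unfold)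
  obtain \<epsilon> where \<epsilon>: "\<epsilon> > 0" "ball z \<epsilon> \<subseteq> U" using U by (metis open_contains_ball)
  have "\<exists>r>0. \<exists>f f'. holomorphic_family z (\<gamma> s0) r f f' \<and>
        (\<forall>w\<in>ball z r. \<forall>s\<in>{0..1} \<inter> ball s0 r. h \<nu> w s = f w (\<gamma> s) \<and> - \<nu> * h (\<nu> - 1) w s = f' w (\<gamma> s))"
    if s0: "s0 \<in> {0..1}" for s0
  proof -
    define t0 where "t0 = \<gamma> s0"
    have nz: "t0 \<noteq> 0" "t0 - z \<noteq> 0"
      using l0'(2)[OF s0] l1'(2)[of "(z, s0)"] U s0 exp_not_eq_zero[of "l0 s0"] exp_not_eq_zero[of "l1 z s0"]
      by (auto simp: t0_def)
    obtain e0 where e0: "e0 > 0"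
      "\<And>s. s \<in> {0..1} \<Longrightarrow> dist s s0 < e0 \<Longrightarrow> l0 s = l0 s0 + Ln (\<gamma> s / t0)"
      unfolding t0_def by (rule log_lift_eq_branch[OF l0' s0]) auto
    obtain e1 where e1: "e1 > 0" "\<And>p. p \<in> U \<times> {0..1} \<Longrightarrow> dist p (z, s0) < e1 \<Longrightarrow>
        l1 (fst p) (snd p) = l1 z s0 + Ln ((\<gamma> (snd p) - fst p) / (t0 - z))"
      using log_lift_eq_branch[OF l1', of "(z, s0)"] U s0 by (auto simp: t0_def)
    \<comment> \<open>The halves occur because \<open>t - w\<close>, and likewise the pair \<open>(w, s)\<close>, moves in two variables at once,
      each by less than \<open>r\<close>.\<close>
    define r where "r = Min {e0, e1 / 2, \<epsilon>, cmod t0, cmod (t0 - z) / 2}"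
    have r: "r > 0" "r \<le> e0" "r \<le> e1 / 2" "r \<le> \<epsilon>" "r \<le> cmod t0" "r \<le> cmod (t0 - z) / 2"
      using e0 e1 \<epsilon> nz by (auto simp: r_def)
    define f where "f = (\<lambda>w t. exp (\<mu> * (l0 s0 + Ln (t / t0))) * exp t *
        exp (\<nu> * (l1 z s0 + Ln ((t - w) / (t0 - z)))))"
    define f' where "f' = (\<lambda>w t. - \<nu> / (t - w) * f w t)"
    have branch0: "t / t0 \<notin> \<real>\<^sub>\<le>\<^sub>0" if "t \<in> ball t0 r" for t
      using that r by (intro divide_notin_nonpos_Reals) (auto simp: dist_commute)
    have branch1: "(t - w) / (t0 - z) \<notin> \<real>\<^sub>\<le>\<^sub>0" if "t \<in> ball t0 r" "w \<in> ball z r" for t w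
    proof (rule divide_notin_nonpos_Reals)
      have "dist (t - w) (t0 - z) \<le> dist t0 t + dist z w"
        using norm_triangle_ineq4[of "t - t0" "w - z"] by (simp add: dist_norm norm_minus_commute algebra_simps)
      then show "dist (t - w) (t0 - z) < cmod (t0 - z)" using that r by simp
    qed
    have tw: "t - w \<noteq> 0" if "t \<in> ball t0 r" "w \<in> ball z r" for t w
      using branch1[OF that] by auto
    have "holomorphic_family z t0 r f f'"
      unfolding holomorphic_family_def
    proof (intro conjI ballI)
      fix w assume w: "w \<in> ball z r"
      show f: "f w holomorphic_on ball t0 r"
        unfolding f_def by (intro holomorphic_intros branch0 branch1 w nz)
      show "f' w holomorphic_on ball t0 r"
        unfolding f'_def by (intro holomorphic_intros f tw w)
      fix t assume t: "t \<in> ball t0 r"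
      show "((\<lambda>w. f w t) has_field_derivative f' w t) (at w)"
      proof -
        have "((\<lambda>w. Ln ((t - w) / (t0 - z))) has_field_derivative - 1 / (t - w)) (at w)"
        proof -
          have "((\<lambda>w. (t - w) / (t0 - z)) has_field_derivative - 1 / (t0 - z)) (at w)"
            by (rule DERIV_cdivide) (auto intro!: derivative_eq_intros)
          from DERIV_chain2[OF has_field_derivative_Ln[OF branch1[OF t w]] this]
          show ?thesis using nz tw[OF t w] by simp
        qed
        moreover have "((\<lambda>w. C * exp (\<nu> * (B + L w))) has_field_derivative
            \<nu> * L' * (C * exp (\<nu> * (B + L w)))) (at w)"
          if "(L has_field_derivative L') (at w)" for B C L L'
          using that by (auto intro!: derivative_eq_intros)
        ultimately show ?thesis
          unfolding f_def f'_def by fastforce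
      qed
    next
      have "continuous_on (ball z r \<times> ball t0 r) (\<lambda>p. f' (fst p) (snd p))"
        unfolding f_def f'_def
        by (intro continuous_intros) (use branch0 branch1 tw nz in auto)
      then show "continuous_on (ball z r \<times> ball t0 r) (\<lambda>(w, t). f' w t)"
        by (simp add: case_prod_unfold)
    qed
    moreover have "h \<nu> w s = f w (\<gamma> s) \<and> - \<nu> * h (\<nu> - 1) w s = f' w (\<gamma> s)"
      if w: "w \<in> ball z r" and s: "s \<in> {0..1} \<inter> ball s0 r" for w s
    proof -
      have "w \<in> U" using w \<epsilon> r by auto
      then have mem: "(w, s) \<in> U \<times> {0..1}" using s by auto
      have "dist (w, s) (z, s0) \<le> dist w z + dist s s0"
        by (simp add: dist_Pair_Pair sqrt_sum_squares_le_sum)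
      also have "\<dots> < e1" using w s r by (simp add: dist_commute)
      finally have L1: "l1 w s = l1 z s0 + Ln ((\<gamma> s - w) / (t0 - z))"
        using e1(2)[OF mem] by simp
      have L0: "l0 s = l0 s0 + Ln (\<gamma> s / t0)"
        using s r by (intro e0(2)) (auto simp: dist_commute)
      have h: "h \<nu> w s = f w (\<gamma> s)"
        by (simp add: h_def f_def pow_of_log_def L0[symmetric] L1[symmetric])
      have e: "exp (l1 w s) = \<gamma> s - w" using l1'(2)[OF mem] by simp
      have "pow_of_log (l1 w s) (\<nu> - 1) = pow_of_log (l1 w s) \<nu> / (\<gamma> s - w)"
        using pow_of_log_add_1[OF e, of "\<nu> - 1"] e exp_not_eq_zero[of "l1 w s"] by simp
      then have "h (\<nu> - 1) w s = h \<nu> w s / (\<gamma> s - w)"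
        by (simp add: h_def)
      then show ?thesis by (simp add: h f'_def)
    qed
    ultimately show ?thesis using r(1) unfolding t0_def by blast
  qed
  then show ?thesis
    by (rule differentiates_under_integral_if_locally_holomorphic[OF \<gamma>])
qed

text \<open>
  The \<open>w\<close>-derivative of \<open>exp (w / t)\<close> contributes a factor \<open>1 / t\<close>, which lowers the exponent of \<open>t\<close>.
\<close>

lemma differentiates_exp_power_integral:
  fixes \<mu> \<nu> :: complex
  assumes \<gamma>: "valid_path \<gamma>"
    and l0: "log_along \<gamma> l0" and l1: "log_along (\<lambda>s. 1 - \<gamma> s) l1"
  defines "h \<equiv> \<lambda>\<mu> w s. exp (w / \<gamma> s) * pow_of_log (l0 s) \<mu> * pow_of_log (l1 s) \<nu>"
  shows "differentiates_under_integral \<gamma> z (h \<mu>) (h (\<mu> - 1))"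
proof -
  have l0': "continuous_on {0..1} l0" "\<And>s. s \<in> {0..1} \<Longrightarrow> exp (l0 s) = \<gamma> s"
    and l1': "continuous_on {0..1} l1" "\<And>s. s \<in> {0..1} \<Longrightarrow> exp (l1 s) = 1 - \<gamma> s"
    using l0 l1 by (auto simp: log_along_def)
  have "\<exists>r>0. \<exists>f f'. holomorphic_family z (\<gamma> s0) r f f' \<and>
        (\<forall>w\<in>ball z r. \<forall>s\<in>{0..1} \<inter> ball s0 r. h \<mu> w s = f w (\<gamma> s) \<and> h (\<mu> - 1) w s = f' w (\<gamma> s))"
    if s0: "s0 \<in> {0..1}" for s0
  proof -
    define t0 where "t0 = \<gamma> s0"
    have nz: "t0 \<noteq> 0" "1 - t0 \<noteq> 0"
      using l0'(2)[OF s0] l1'(2)[OF s0] exp_not_eq_zero[of "l0 s0"] exp_not_eq_zero[of "l1 s0"]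
      by (auto simp: t0_def)
    obtain e0 where e0: "e0 > 0"
      "\<And>s. s \<in> {0..1} \<Longrightarrow> dist s s0 < e0 \<Longrightarrow> l0 s = l0 s0 + Ln (\<gamma> s / t0)"
      unfolding t0_def by (rule log_lift_eq_branch[OF l0' s0]) auto
    obtain e1 where e1: "e1 > 0"
      "\<And>s. s \<in> {0..1} \<Longrightarrow> dist s s0 < e1 \<Longrightarrow> l1 s = l1 s0 + Ln ((1 - \<gamma> s) / (1 - t0))"
      unfolding t0_def by (rule log_lift_eq_branch[OF l1' s0]) auto
    define r where "r = Min {e0, e1, cmod t0, cmod (1 - t0)}"
    have r: "r > 0" "r \<le> e0" "r \<le> e1" "r \<le> cmod t0" "r \<le> cmod (1 - t0)"
      using e0 e1 nz by (auto simp: r_def)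
    define f where "f = (\<lambda>w t. exp (w / t) * exp (\<mu> * (l0 s0 + Ln (t / t0))) *
        exp (\<nu> * (l1 s0 + Ln ((1 - t) / (1 - t0)))))"
    define f' where "f' = (\<lambda>w t. f w t / t)"
    have branch0: "t / t0 \<notin> \<real>\<^sub>\<le>\<^sub>0" if "t \<in> ball t0 r" for t
      using that r by (intro divide_notin_nonpos_Reals) (auto simp: dist_commute)
    have branch1: "(1 - t) / (1 - t0) \<notin> \<real>\<^sub>\<le>\<^sub>0" if "t \<in> ball t0 r" for t
      using that r by (intro divide_notin_nonpos_Reals) (auto simp: dist_norm)
    have tnz: "t \<noteq> 0" if "t \<in> ball t0 r" for t
      using branch0[OF that] by auto
    have "holomorphic_family z t0 r f f'"
      unfolding holomorphic_family_def
    proof (intro conjI ballI)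
      fix w assume w: "w \<in> ball z r"
      show f: "f w holomorphic_on ball t0 r"
        unfolding f_def by (intro holomorphic_intros branch0 branch1 tnz nz)
      show "f' w holomorphic_on ball t0 r"
        unfolding f'_def by (intro holomorphic_intros f tnz)
      fix t assume t: "t \<in> ball t0 r"
      show "((\<lambda>w. f w t) has_field_derivative f' w t) (at w)"
        unfolding f_def f'_def using tnz[OF t]
        by (auto intro!: derivative_eq_intros simp: field_simps)
    next
      have "continuous_on (ball z r \<times> ball t0 r) (\<lambda>p. f' (fst p) (snd p))"
        unfolding f_def f'_def
        by (intro continuous_intros) (use branch0 branch1 tnz nz in auto)
      then show "continuous_on (ball z r \<times> ball t0 r) (\<lambda>(w, t). f' w t)"
        by (simp add: case_prod_unfold)
    qed
    moreover have "h \<mu> w s = f w (\<gamma> s) \<and> h (\<mu> - 1) w s = f' w (\<gamma> s)"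
      if w: "w \<in> ball z r" and s: "s \<in> {0..1} \<inter> ball s0 r" for w s
    proof -
      have s01: "s \<in> {0..1}" using s by simp
      have L0: "l0 s = l0 s0 + Ln (\<gamma> s / t0)" and L1: "l1 s = l1 s0 + Ln ((1 - \<gamma> s) / (1 - t0))"
        using s r by (auto intro!: e0(2) e1(2) simp: dist_commute)
      have h: "h \<mu> w s = f w (\<gamma> s)"
        by (simp add: h_def f_def pow_of_log_def L0[symmetric] L1[symmetric])
      have "pow_of_log (l0 s) (\<mu> - 1) = pow_of_log (l0 s) \<mu> / \<gamma> s"
        using pow_of_log_add_1[OF l0'(2)[OF s01], of "\<mu> - 1"] l0'(2)[OF s01] exp_not_eq_zero[of "l0 s"]
        by simp
      then have "h (\<mu> - 1) w s = h \<mu> w s / \<gamma> s"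
        by (simp add: h_def)
      then show ?thesis by (simp add: h f'_def)
    qed
    ultimately show ?thesis using r(1) unfolding t0_def by blast
  qed
  then show ?thesis
    by (rule differentiates_under_integral_if_locally_holomorphic[OF \<gamma>])
qed

section \<open>Annihilation by the confluent operator\<close>

text \<open>
  The fundamental theorem of calculus on a covering: \<open>E\<close> is a function of the curve parameter, and
  \<open>g\<close> plays the role of its derivative with respect to the point of the curve.
\<close>

lemma has_integral_exact_form:
  assumes \<gamma>: "valid_path \<gamma>" and cont: "continuous_on {0..1} E"
    and deriv: "\<And>s d. s \<in> {0..1} \<Longrightarrow> (\<gamma> has_vector_derivative d) (at s within {0..1}) \<Longrightarrow>
                  (E has_vector_derivative g s * d) (at s within {0..1})"
  shows "((\<lambda>s. g s * vector_derivative \<gamma> (at s within {0..1})) has_integral endpoint_diff E) {0..1}"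
proof -
  have "\<gamma> piecewise_differentiable_on {0..1}"
    using \<gamma> by (simp add: valid_path_def piecewise_C1_imp_differentiable)
  then obtain S where S: "finite S" "\<And>s. s \<in> {0..1} - S \<Longrightarrow> \<gamma> differentiable (at s within {0..1})"
    by (auto simp: piecewise_differentiable_on_def)
  show ?thesis
    unfolding endpoint_diff_def
  proof (rule fundamental_theorem_of_calculus_interior_strong[OF S(1) _ _ cont])
    fix s :: real assume s: "s \<in> {0<..<1} - S"
    then have s01: "s \<in> {0..1}" by auto
    have "\<gamma> differentiable (at s within {0..1})" using s by (intro S(2)) auto
    from deriv[OF s01 this[unfolded vector_derivative_works]]
    show "(E has_vector_derivative g s * vector_derivative \<gamma> (at s within {0..1})) (at s)"
      using s by (simp add: at_within_Icc_at)
  qed simp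
qed

lemma confluent_op_eq:
  assumes "\<rho> > 0" and f: "\<And>w. w \<in> ball z \<rho> \<Longrightarrow> (f has_field_derivative f1 w) (at w)"
    and f1: "(f1 has_field_derivative f2) (at z)"
  shows "f analytic_on {z}" and "confluent_op a c f z = z * f2 + (c - z) * f1 z - a * f z"
proof -
  have z: "z \<in> ball z \<rho>" using assms(1) by simp
  show "f analytic_on {z}"
    unfolding analytic_at using f z by (metis holomorphic_on_open open_ball)
  have "(deriv f has_field_derivative f2) (at z)"
    by (rule has_field_derivative_transform_within_open[OF f1 open_ball z])
      (metis DERIV_imp_deriv f)
  then show "confluent_op a c f z = z * f2 + (c - z) * f1 z - a * f z"
    using f[OF z] by (simp add: confluent_op_def DERIV_imp_deriv)
qed

text \<open>
  The common last step of both parts. The integrand \<open>h0\<close> and its first two \<open>w\<close>-derivatives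
  \<open>k1 h1\<close> and \<open>k1 k2 h2\<close> combine under the operator to a multiple of an exact form with vanishing
  endpoint difference. The assumption on \<open>h2\<close> supplies its integrability.
\<close>

lemma confluent_op_lifted_contour_integral_eq_0:
  assumes \<gamma>: "valid_path \<gamma>"
    and J0: "differentiates_under_integral \<gamma> z h0 (\<lambda>w s. k1 * h1 w s)"
    and J1: "differentiates_under_integral \<gamma> z h1 (\<lambda>w s. k2 * h2 w s)"
    and J2: "differentiates_under_integral \<gamma> z h2 h3"
    and E: "continuous_on {0..1} E" "endpoint_diff E = 0"
    and exact: "\<And>s d. s \<in> {0..1} \<Longrightarrow> (\<gamma> has_vector_derivative d) (at s within {0..1}) \<Longrightarrow>
                  (E has_vector_derivative g s * d) (at s within {0..1})"
    and comb: "\<And>s. s \<in> {0..1} \<Longrightarrow>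
                  z * (k1 * k2 * h2 z s) + (c - z) * (k1 * h1 z s) - a * h0 z s = k * g s"
  shows "(\<lambda>w. lifted_contour_integral \<gamma> (h0 w)) analytic_on {z}"
    and "confluent_op a c (\<lambda>w. lifted_contour_integral \<gamma> (h0 w)) z = 0"
proof -
  let ?v = "\<lambda>s. vector_derivative \<gamma> (at s within {0..1})"
  let ?J = "\<lambda>h. lifted_contour_integral \<gamma> (h z)"
  have at_z: "(\<lambda>s. h z s * ?v s) integrable_on {0..1} \<and>
      ((\<lambda>w. lifted_contour_integral \<gamma> (h w)) has_field_derivative lifted_contour_integral \<gamma> (h' z)) (at z)"
    if "differentiates_under_integral \<gamma> z h h'" for h h'
    using that unfolding differentiates_under_integral_def by (elim exE conjE ballE[of _ _ z]) simp_all
  have scale: "lifted_contour_integral \<gamma> (\<lambda>s. k * h s) = k * lifted_contour_integral \<gamma> h" for k h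
    by (simp add: lifted_contour_integral_def mult.assoc)
  obtain \<rho> where \<rho>: "\<rho> > 0" "\<forall>w\<in>ball z \<rho>. (\<lambda>s. h0 w s * ?v s) integrable_on {0..1} \<and>
      ((\<lambda>w. lifted_contour_integral \<gamma> (h0 w)) has_field_derivative
         lifted_contour_integral \<gamma> (\<lambda>s. k1 * h1 w s)) (at w)"
    using J0 unfolding differentiates_under_integral_def by (elim exE conjE) (rule that)
  have der0: "((\<lambda>w. lifted_contour_integral \<gamma> (h0 w)) has_field_derivative
      k1 * lifted_contour_integral \<gamma> (h1 w)) (at w)" if "w \<in> ball z \<rho>" for w
    using bspec[OF \<rho>(2) that] unfolding scale by (rule conjunct2)
  have der1: "((\<lambda>w. k1 * lifted_contour_integral \<gamma> (h1 w)) has_field_derivative k1 * (k2 * ?J h2)) (at z)"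
    using at_z[OF J1, THEN conjunct2] unfolding scale by (rule DERIV_cmult)
  note op = confluent_op_eq[OF \<rho>(1) der0 der1]
  show "(\<lambda>w. lifted_contour_integral \<gamma> (h0 w)) analytic_on {z}"
    by (rule op(1))
  have hi: "((\<lambda>s. h0 z s * ?v s) has_integral ?J h0) {0..1}"
    "((\<lambda>s. h1 z s * ?v s) has_integral ?J h1) {0..1}"
    "((\<lambda>s. h2 z s * ?v s) has_integral ?J h2) {0..1}"
    unfolding lifted_contour_integral_def
    by (rule integrable_integral[OF conjunct1] at_z[OF J0] at_z[OF J1] at_z[OF J2])+
  have "((\<lambda>s. z * k1 * k2 * (h2 z s * ?v s) + (c - z) * k1 * (h1 z s * ?v s) - a * (h0 z s * ?v s))
      has_integral z * k1 * k2 * ?J h2 + (c - z) * k1 * ?J h1 - a * ?J h0) {0..1}"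
    by (intro has_integral_diff has_integral_add has_integral_mult_right hi)
  moreover have "z * k1 * k2 * (h2 z s * ?v s) + (c - z) * k1 * (h1 z s * ?v s) - a * (h0 z s * ?v s)
      = k * (g s * ?v s)" if "s \<in> {0..1}" for s
  proof -
    have "z * k1 * k2 * (h2 z s * ?v s) + (c - z) * k1 * (h1 z s * ?v s) - a * (h0 z s * ?v s)
      = (z * (k1 * k2 * h2 z s) + (c - z) * (k1 * h1 z s) - a * h0 z s) * ?v s"
      by (simp add: algebra_simps)
    also have "\<dots> = k * (g s * ?v s)"
      unfolding comb[OF that] by (simp add: mult.assoc)
    finally show ?thesis .
  qed
  ultimately have "((\<lambda>s. k * (g s * ?v s)) has_integral
      z * k1 * k2 * ?J h2 + (c - z) * k1 * ?J h1 - a * ?J h0) {0..1}"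
    by (rule has_integral_eq[rotated])
  moreover have "((\<lambda>s. k * (g s * ?v s)) has_integral k * endpoint_diff E) {0..1}"
    by (intro has_integral_mult_right has_integral_exact_form \<gamma> E(1) exact)
  ultimately have "z * k1 * k2 * ?J h2 + (c - z) * k1 * ?J h1 - a * ?J h0 = k * endpoint_diff E"
    by (rule has_integral_unique)
  then show "confluent_op a c (\<lambda>w. lifted_contour_integral \<gamma> (h0 w)) z = 0"
    using op(2)[where a = a and c = c] E(2) by (simp add: mult.assoc)
qed

text \<open>
  With \<open>X = t\<^bsup>a-c\<^esup> e\<^sup>t (t - z)\<^bsup>-a-2\<^esup>\<close>, both sides of the identity \<open>comb\<close> equal
  \<open>a X ((a + 1) z + (c - z) (t - z) - (t - z)\<^sup>2)\<close>.
\<close>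

lemma confluent_op_shifted_power_integral:
  assumes \<gamma>: "valid_path \<gamma>" and U: "open U" "z \<in> U"
    and l0: "log_along \<gamma> l0" and l1: "log_along_shifted U \<gamma> l1"
    and ends: "endpoint_diff (\<lambda>s. pow_of_log (l0 s) (a - c + 1) * exp (\<gamma> s)
                 * pow_of_log (l1 z s) (- a - 1)) = 0"
  defines "I \<equiv> \<lambda>w. lifted_contour_integral \<gamma>
                 (\<lambda>s. pow_of_log (l0 s) (a - c) * exp (\<gamma> s) * pow_of_log (l1 w s) (- a))"
  shows "I analytic_on {z}" and "confluent_op a c I z = 0"
proof -
  define h where "h = (\<lambda>\<nu> w s. pow_of_log (l0 s) (a - c) * exp (\<gamma> s) * pow_of_log (l1 w s) \<nu>)"
  define E where "E = (\<lambda>s. pow_of_log (l0 s) (a - c + 1) * exp (\<gamma> s) * pow_of_log (l1 z s) (- a - 1))"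
  define g where "g = (\<lambda>s. (a - c + 1) * h (- a - 1) z s + \<gamma> s * h (- a - 1) z s
      - (a + 1) * \<gamma> s * h (- a - 1 - 1) z s)"
  have deriv: "differentiates_under_integral \<gamma> z (h \<nu>) (\<lambda>w s. - \<nu> * h (\<nu> - 1) w s)" for \<nu>
    unfolding h_def by (rule differentiates_shifted_power_integral[OF \<gamma> U l0 l1])
  have l1z: "log_along (\<lambda>s. \<gamma> s - z) (l1 z)"
    unfolding log_along_def
  proof
    have "continuous_on {0..1} (\<lambda>s. case (z, s) of (w, s) \<Rightarrow> l1 w s)"
      by (rule continuous_on_compose2[of "U \<times> {0..1}"])
        (use l1 U in \<open>auto simp: log_along_shifted_def intro!: continuous_intros\<close>)
    then show "continuous_on {0..1} (l1 z)" by simp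
  qed (use l1 U in \<open>auto simp: log_along_shifted_def\<close>)
  have cont: "continuous_on {0..1} \<gamma>"
    using \<gamma> by (simp add: valid_path_def piecewise_C1_differentiable_on_def)
  have E: "continuous_on {0..1} E"
    unfolding E_def by (intro continuous_intros continuous_on_pow_of_log[OF l0] continuous_on_pow_of_log[OF l1z] cont)
  \<comment> \<open>The powers of \<open>t\<close>, and those of \<open>t - z\<close>, in the integrands and in \<open>E\<close> differ by integer exponents;
    these rules reduce them to common factors, after which only polynomials in \<open>t\<close> remain.\<close>
  have lower0: "pow_of_log (l0 s) (a - c + 1) = pow_of_log (l0 s) (a - c) * \<gamma> s" if "s \<in> {0..1}" for s
    by (rule pow_of_log_add_1) (use l0 that in \<open>auto simp: log_along_def\<close>)
  have lower1: "pow_of_log (l1 z s) \<nu> = pow_of_log (l1 z s) (\<nu> - 1) * (\<gamma> s - z)" if "s \<in> {0..1}" for s \<nu>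
    using pow_of_log_add_1[of "l1 z s" "\<gamma> s - z" "\<nu> - 1"] l1z that by (auto simp: log_along_def)
  have exact: "(E has_vector_derivative g s * d) (at s within {0..1})"
    if s: "s \<in> {0..1}" and d: "(\<gamma> has_vector_derivative d) (at s within {0..1})" for s d
  proof -
    have "(exp has_field_derivative exp (\<gamma> s)) (at (\<gamma> s) within \<gamma> ` {0..1})"
      by (auto intro!: derivative_eq_intros)
    from field_vector_diff_chain_within[OF d this]
    have e: "((\<lambda>s. exp (\<gamma> s)) has_vector_derivative d * exp (\<gamma> s)) (at s within {0..1})"
      by (simp add: o_def)
    have d': "((\<lambda>s. \<gamma> s - z) has_vector_derivative d) (at s within {0..1})"
      using has_vector_derivative_diff[OF d has_vector_derivative_const] by simp
    show ?thesis
      unfolding E_def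
      by (rule has_vector_derivative_eq_rhs[OF has_vector_derivative_mult[OF has_vector_derivative_mult[OF
              has_vector_derivative_pow_of_log[OF l0 s d] e] has_vector_derivative_pow_of_log[OF l1z s d']]],
          unfold g_def h_def lower0[OF s], simp add: algebra_simps)
  qed
  have comb: "z * (- (- a) * - (- a - 1) * h (- a - 1 - 1) z s) + (c - z) * (- (- a) * h (- a - 1) z s)
      - a * h (- a) z s = - a * g s" if s: "s \<in> {0..1}" for s
  proof -
    define X where "X = h (- a - 1 - 1) z s"
    have h1: "h (- a - 1) z s = X * (\<gamma> s - z)"
      unfolding h_def X_def lower1[OF s, of "- a - 1"] by (simp only: mult.assoc)
    have h0: "h (- a) z s = X * (\<gamma> s - z) * (\<gamma> s - z)"
      unfolding h1[symmetric] unfolding h_def lower1[OF s, of "- a"] by (simp only: mult.assoc)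
    show ?thesis
      unfolding g_def h0 h1 X_def[symmetric] by (simp add: algebra_simps)
  qed
  have I: "I = (\<lambda>w. lifted_contour_integral \<gamma> (h (- a) w))"
    by (simp add: I_def h_def)
  note * = confluent_op_lifted_contour_integral_eq_0[OF \<gamma> deriv deriv deriv E ends[folded E_def] exact comb]
  show "I analytic_on {z}" and "confluent_op a c I z = 0"
    unfolding I by (rule *; assumption)+
qed

text \<open>
  With \<open>X = e\<^bsup>z/t\<^esup> t\<^bsup>-c-2\<^esup> (1 - t)\<^bsup>c-a-1\<^esup>\<close>, both sides of the identity \<open>comb\<close> equal
  \<open>X (z + (c - z) t - a t\<^sup>2)\<close>.
\<close>

lemma confluent_op_exp_power_integral:
  assumes \<gamma>: "valid_path \<gamma>"
    and l0: "log_along \<gamma> l0" and l1: "log_along (\<lambda>s. 1 - \<gamma> s) l1"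
    and ends: "endpoint_diff (\<lambda>s. exp (z / \<gamma> s) * pow_of_log (l0 s) (- c)
                 * pow_of_log (l1 s) (c - a)) = 0"
  defines "I \<equiv> \<lambda>w. lifted_contour_integral \<gamma>
                 (\<lambda>s. exp (w / \<gamma> s) * pow_of_log (l0 s) (- c) * pow_of_log (l1 s) (c - a - 1))"
  shows "I analytic_on {z}" and "confluent_op a c I z = 0"
proof -
  define h where "h = (\<lambda>\<mu> w s. exp (w / \<gamma> s) * pow_of_log (l0 s) \<mu> * pow_of_log (l1 s) (c - a - 1))"
  define E where "E = (\<lambda>s. exp (z / \<gamma> s) * pow_of_log (l0 s) (- c) * pow_of_log (l1 s) (c - a))"
  define g where "g = (\<lambda>s. - z * (1 - \<gamma> s) * h (- c - 1 - 1) z s - c * (1 - \<gamma> s) * h (- c - 1) z s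
      - (c - a) * h (- c) z s)"
  have deriv: "differentiates_under_integral \<gamma> z (h \<mu>) (\<lambda>w s. 1 * h (\<mu> - 1) w s)" for \<mu>
    unfolding h_def mult_1 by (rule differentiates_exp_power_integral[OF \<gamma> l0 l1])
  have nz: "\<gamma> s \<noteq> 0" if "s \<in> {0..1}" for s
    using l0 that exp_not_eq_zero[of "l0 s"] by (auto simp: log_along_def)
  have cont: "continuous_on {0..1} \<gamma>"
    using \<gamma> by (simp add: valid_path_def piecewise_C1_differentiable_on_def)
  have E: "continuous_on {0..1} E"
    unfolding E_def
    by (intro continuous_intros continuous_on_pow_of_log[OF l0] continuous_on_pow_of_log[OF l1] cont) (use nz in auto)
  have lower0: "pow_of_log (l0 s) \<mu> = pow_of_log (l0 s) (\<mu> - 1) * \<gamma> s" if "s \<in> {0..1}" for s \<mu>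
    using pow_of_log_add_1[of "l0 s" "\<gamma> s" "\<mu> - 1"] l0 that by (auto simp: log_along_def)
  have lower1: "pow_of_log (l1 s) (c - a) = pow_of_log (l1 s) (c - a - 1) * (1 - \<gamma> s)" if "s \<in> {0..1}" for s
    using pow_of_log_add_1[of "l1 s" "1 - \<gamma> s" "c - a - 1"] l1 that by (auto simp: log_along_def)
  have h1: "h (- c - 1) z s = h (- c - 1 - 1) z s * \<gamma> s" if s: "s \<in> {0..1}" for s
    unfolding h_def lower0[OF s, of "- c - 1"] by (simp only: ac_simps)
  have h0: "h (- c) z s = h (- c - 1 - 1) z s * \<gamma> s * \<gamma> s" if s: "s \<in> {0..1}" for s
    unfolding h1[OF s, symmetric] unfolding h_def lower0[OF s, of "- c"] by (simp only: ac_simps)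
  have exact: "(E has_vector_derivative g s * d) (at s within {0..1})"
    if s: "s \<in> {0..1}" and d: "(\<gamma> has_vector_derivative d) (at s within {0..1})" for s d
  proof -
    have "((\<lambda>t. exp (z / t)) has_field_derivative - z / (\<gamma> s * \<gamma> s) * exp (z / \<gamma> s)) (at (\<gamma> s) within \<gamma> ` {0..1})"
      using nz[OF s] by (auto intro!: derivative_eq_intros)
    from field_vector_diff_chain_within[OF d this]
    have e: "((\<lambda>s. exp (z / \<gamma> s)) has_vector_derivative d * (- z / (\<gamma> s * \<gamma> s) * exp (z / \<gamma> s))) (at s within {0..1})"
      by (simp add: o_def)
    have d': "((\<lambda>s. 1 - \<gamma> s) has_vector_derivative - d) (at s within {0..1})"
      using has_vector_derivative_diff[OF has_vector_derivative_const d] by simp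
    define X where "X = h (- c - 1 - 1) z s"
    have p: "exp (z / \<gamma> s) * pow_of_log (l0 s) (- c - 1 - 1) * pow_of_log (l1 s) (c - a - 1) = X"
      by (simp add: X_def h_def)
    show ?thesis
      unfolding E_def
      by (rule has_vector_derivative_eq_rhs[OF has_vector_derivative_mult[OF has_vector_derivative_mult[OF
              e has_vector_derivative_pow_of_log[OF l0 s d]] has_vector_derivative_pow_of_log[OF l1 s d']]],
          unfold g_def h0[OF s] h1[OF s] X_def[symmetric],
          unfold p[symmetric] lower1[OF s] lower0[OF s, of "- c"] lower0[OF s, of "- c - 1"])
        (use nz[OF s] in \<open>simp add: field_simps\<close>)
  qed
  have comb: "z * (1 * 1 * h (- c - 1 - 1) z s) + (c - z) * (1 * h (- c - 1) z s)
      - a * h (- c) z s = - 1 * g s" if s: "s \<in> {0..1}" for s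
    unfolding g_def h0[OF s] h1[OF s] by (simp add: algebra_simps)
  have I: "I = (\<lambda>w. lifted_contour_integral \<gamma> (h (- c) w))"
    by (simp add: I_def h_def)
  note * = confluent_op_lifted_contour_integral_eq_0[OF \<gamma> deriv deriv deriv E ends[folded E_def] exact comb]
  show "I analytic_on {z}" and "confluent_op a c I z = 0"
    unfolding I by (rule *; assumption)+
qed

theorem theorem4p1:
  fixes a c :: complex
  shows
    "(\<forall>(\<gamma> :: real \<Rightarrow> complex) U z l0 l1.
        valid_path \<gamma> \<and> open U \<and> z \<in> U \<and>
        log_along \<gamma> l0 \<and> log_along_shifted U \<gamma> l1 \<and>
        endpoint_diff (\<lambda>s. pow_of_log (l0 s) (a - c + 1) * exp (\<gamma> s)
                             * pow_of_log (l1 z s) (- a - 1)) = 0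
        \<longrightarrow>
        (let I = (\<lambda>w. lifted_contour_integral \<gamma>
                   (\<lambda>s. pow_of_log (l0 s) (a - c) * exp (\<gamma> s) * pow_of_log (l1 w s) (- a)))
         in I analytic_on {z} \<and> confluent_op a c I z = 0))
     \<and>
     (\<forall>(\<gamma> :: real \<Rightarrow> complex) z l0 l1.
        valid_path \<gamma> \<and>
        log_along \<gamma> l0 \<and> log_along (\<lambda>s. 1 - \<gamma> s) l1 \<and>
        endpoint_diff (\<lambda>s. exp (z / \<gamma> s) * pow_of_log (l0 s) (- c)
                             * pow_of_log (l1 s) (c - a)) = 0
        \<longrightarrow>
        (let I = (\<lambda>w. lifted_contour_integral \<gamma>
                   (\<lambda>s. exp (w / \<gamma> s) * pow_of_log (l0 s) (- c) * pow_of_log (l1 s) (c - a - 1)))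
         in I analytic_on {z} \<and> confluent_op a c I z = 0))"
  unfolding Let_def
  by (intro conjI allI impI; elim conjE; rule confluent_op_shifted_power_integral
      confluent_op_exp_power_integral; assumption)

end
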